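(* Consider the R-ESAV-2/BDF$k$ scheme ($1\le k\le 6$), as defined in the context, for the dissipative system $\partial_t\phi+\mathcal A\phi+g(\phi)=0$, with time step $\delta t>0$. At each time step let $(\phi^{n+1},\tilde R^{n+1},\xi^{n+1})$ be the output of Step 1, and choose $\theta_0^{n+1}$ and $\gamma^{n+1}$ in Step 2 as follows: 1. If $\tilde R^{n+1}=\exp(E(\phi^{n+1}))$, set $\theta_0^{n+1}=0$ and $\gamma^{n+1}=\dfrac{\mathcal K(B_k(\phi^n))}{\mathcal K(\phi^{n+1})}$. 2. If $\tilde R^{n+1}>\exp(E(\phi^{n+1}))$, set $\theta_0^{n+1}=0$ and $$\gamma^{n+1}=\frac{\tilde R^{n+1}-\exp(E(\phi^{n+1}))}{\delta t\,\tilde R^{n+1}\mathcal K(\phi^{n+1})}+\frac{\mathcal K(B_k(\phi^n))}{\mathcal K(\phi^{n+1})}.$$ 3. If $\tilde R^{n+1}<\exp(E(\phi^{n+1}))$ and $\tilde R^{n+1}-\exp(E(\phi^{n+1}))+\delta t\,\tilde R^{n+1}\mathcal K(B_k(\phi^n))\ge0$, set $\theta_0^{n+1}=0$ and $\gamma^{n+1}$ by the same formula as in case 2. 4. If $\tilde R^{n+1}<\exp(E(\phi^{n+1}))$ and $\tilde R^{n+1}-\exp(E(\phi^{n+1}))+\delta t\,\tilde R^{n+1}\mathcal K(B_k(\phi^n))<0$, set $$\theta_0^{n+1}=1-\frac{\delta t\,\tilde R^{n+1}\mathcal K(B_k(\phi^n))}{\exp(E(\phi^{n+1}))-\tilde R^{n+1}},\qquad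 \gamma^{n+1}=0.$$ Then in all cases $$\big(\tilde R^{n+1}-\exp(E(\phi^{n+1}))\big)\theta_0^{n+1}=\tilde R^{n+1}-\exp(E(\phi^{n+1}))-\delta t\,\gamma^{n+1}\tilde R^{n+1}\mathcal K(\phi^{n+1})+\delta t\,\tilde R^{n+1}\mathcal K(B_k(\phi^n))$$ and $\theta_0^{n+1}\in\mathcal W$. Moreover $R^{n+1}>0$ and $\xi^{n+1}>0$, and the scheme with this choice of $\theta_0^{n+1}$ and $\gamma^{n+1}$ is unconditionally energy stable (for every $\delta t>0$) in the sense that $$R^{n+1}-R^n=-\delta t\,\gamma^{n+1}\tilde R^{n+1}\mathcal K(\phi^{n+1})\le0,$$ and $$\ln(R^{n+1})-\ln(R^n)\le0.$$ Furthermore, $R^{n+1}\le\exp(E(\phi^{n+1}))$ for all $n\ge0$ (that is, at every time step computed by the scheme).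
   Context: Setting. $\mathcal A$ is a positive operator and $g$ is a semi-linear or quasi-linear operator. The system $\partial_t\phi+\mathcal A\phi+g(\phi)=0$ is assumed to satisfy the energy dissipation law $\frac{d}{dt}E(\phi)=-\mathcal K(\phi)$, where $E(\phi)>-C_0$ is a free energy (bounded below by a constant) and $\mathcal K(\phi)>0$ for all $\phi$. All functions are assumed to lie in spaces where the expressions below make sense. BDF operators: $\alpha_k,A_k,B_k$ are those of the $k$-step backward differentiation formula and the $k$-th order extrapolation: $k=1$: $\alpha_1=1$, $A_1(\phi^n)=\phi^n$, $B_1(\phi^n)=\phi^n$. $k=2$: $\alpha_2=\frac32$, $A_2(\phi^n)=2\phi^n-\frac12\phi^{n-1}$, $B_2(\phi^n)=2\phi^n-\phi^{n-1}$. $k=3$: $\alpha_3=\frac{11}6$, $A_3(\phi^n)=3\phi^n-\frac32\phi^{n-1}+\frac13\phi^{n-2}$, $B_3(\phi^n)=3\phi^n-3\phi^{n-1}+\phi^{n-2}$. $k=4$: $\alpha_4=\frac{25}{12}$, $A_4(\phi^n)=4\phi^n-3\phi^{n-1}+\frac43\phi^{n-2}-\frac14\phi^{n-3}$, $B_4(\phi^n)=4\phi^n-6\phi^{n-1}+4\phi^{n-2}-\phi^{n-3}$. $k=5$: $\alpha_5=\frac{137}{60}$, $A_5(\phi^n)=5\phi^n-5\phi^{n-1}+\frac{10}3\phi^{n-2}-\frac54\phi^{n-3}+\frac15\phi^{n-4}$, $B_5(\phi^n)=5\phi^n-10\phi^{n-1}+10\phi^{n-2}-5\phi^{n-3}+\phi^{n-4}$.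 $k=6$: $\alpha_6=\frac{49}{20}$, $A_6(\phi^n)=6\phi^n-\frac{15}2\phi^{n-1}+\frac{20}3\phi^{n-2}-\frac{15}4\phi^{n-3}+\frac65\phi^{n-4}-\frac16\phi^{n-5}$, $B_6(\phi^n)=6\phi^n-15\phi^{n-1}+20\phi^{n-2}-15\phi^{n-3}+6\phi^{n-4}-\phi^{n-5}$. The functions $V_k$: $V_1(\xi)=\xi$, $V_2(\xi)=\xi(2-\xi)$, $V_3(\xi)=\xi(3-3\xi+\xi^2)$, $V_4(\xi)=\xi(2-\xi)(2-2\xi+\xi^2)$; for $k=5,6$, $V_k$ is some fixed real function with $V_k(1)=1$. R-ESAV-2/BDF$k$ scheme. Previous values $\phi^n,\phi^{n-1},\dots$ (as many as needed by $A_k,B_k$) and $R^n>0$ are given; $R$ discretizes the scalar auxiliary variable $R(t)=\exp(E(\phi(t)))$, with positive initial value. Step 1: find $(\phi^{n+1},\tilde R^{n+1},\xi^{n+1})$ satisfying $$\frac{\alpha_k\phi^{n+1}-A_k(\phi^n)}{\delta t}+\mathcal A\phi^{n+1}+V_k(\xi^{n+1})\,g(B_k(\phi^n))=0,$$ $$\frac{\tilde R^{n+1}-R^n}{\delta t}=-\tilde R^{n+1}\mathcal K(B_k(\phi^n)),\qquad \xi^{n+1}=\frac{\tilde R^{n+1}}{\exp(E(B_k(\phi^n)))}.$$ Step 2: set $R^{n+1}=\theta_0^{n+1}\tilde R^{n+1}+(1-\theta_0^{n+1})\exp(E(\phi^{n+1}))$ with $\theta_0^{n+1}\in\mathcal W$.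 Here $\mathcal W$ (depending on a number $\gamma^{n+1}\ge0$ to be chosen) is the set of $\theta\in[0,1]$ such that $R_\theta:=\theta\tilde R^{n+1}+(1-\theta)\exp(E(\phi^{n+1}))$ satisfies $$\frac{R_\theta-\tilde R^{n+1}}{\delta t}=-\gamma^{n+1}\tilde R^{n+1}\mathcal K(\phi^{n+1})+\tilde R^{n+1}\mathcal K(B_k(\phi^n)).$$ *)

theory Defs
  imports "HOL-Analysis.Analysis"
begin

text \<open>
  The system lives in a real inner product space \<open>'a\<close> (such as \<open>L\<^sup>2\<close>); \<open>D\<close> is the linear subspace
  of functions regular enough for \<open>\<A>\<close>, \<open>g\<close>, \<open>E\<close> and \<open>\<K>\<close> to be defined. HOL functions being total,
  nothing is assumed about their values outside \<open>D\<close>.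
\<close>

text \<open>
  Unbounded operators are allowed. Positivity means \<open>\<langle>\<A>x, x\<rangle> \<ge> 0\<close>; neither symmetry nor strict
  positivity is required, so that for instance \<open>-\<Delta>\<close> with periodic boundary conditions qualifies.
\<close>

definition positive_operator_on :: "'a::real_inner set \<Rightarrow> ('a \<Rightarrow> 'a) \<Rightarrow> bool" where
  "positive_operator_on D \<A> \<longleftrightarrow>
     subspace D \<and>
     (\<forall>x\<in>D. \<forall>y\<in>D. \<A> (x + y) = \<A> x + \<A> y) \<and>
     (\<forall>c. \<forall>x\<in>D. \<A> (c *\<^sub>R x) = c *\<^sub>R \<A> x) \<and>
     (\<forall>x\<in>D. 0 \<le> \<A> x \<bullet> x)"

definition solves_system ::
  "'a::real_inner set \<Rightarrow> ('a \<Rightarrow> 'a) \<Rightarrow> ('a \<Rightarrow> 'a) \<Rightarrow> real set \<Rightarrow> (real \<Rightarrow> 'a) \<Rightarrow> bool" where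
  "solves_system D \<A> g I u \<longleftrightarrow>
     (\<forall>t\<in>I. u t \<in> D \<and> u differentiable (at t) \<and>
        vector_derivative u (at t) + \<A> (u t) + g (u t) = 0)"

definition energy_dissipation_law ::
  "'a::real_inner set \<Rightarrow> ('a \<Rightarrow> 'a) \<Rightarrow> ('a \<Rightarrow> 'a) \<Rightarrow> ('a \<Rightarrow> real) \<Rightarrow> ('a \<Rightarrow> real) \<Rightarrow> bool" where
  "energy_dissipation_law D \<A> g E \<K> \<longleftrightarrow>
     (\<forall>a b u. solves_system D \<A> g {a<..<b} u \<longrightarrow>
        (\<forall>t\<in>{a<..<b}. ((\<lambda>s. E (u s)) has_real_derivative - \<K> (u t)) (at t)))"

text \<open>
  Semi- or quasi-linearity of \<open>g\<close> puts no condition on \<open>g\<close> as a map between abstract spaces.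
\<close>

definition dissipative_system ::
  "'a::real_inner set \<Rightarrow> ('a \<Rightarrow> 'a) \<Rightarrow> ('a \<Rightarrow> 'a) \<Rightarrow> ('a \<Rightarrow> real) \<Rightarrow> ('a \<Rightarrow> real) \<Rightarrow> bool" where
  "dissipative_system D \<A> g E \<K> \<longleftrightarrow>
     positive_operator_on D \<A> \<and>
     (\<exists>C\<^sub>0. \<forall>u\<in>D. E u > - C\<^sub>0) \<and>
     (\<forall>u\<in>D. \<K> u > 0) \<and>
     energy_dissipation_law D \<A> g E \<K>"

text \<open>
  In the following three definitions \<open>k\<close> ranges over \<open>1, \<dots>, 6\<close>, the last branch being \<open>k = 6\<close>. The
  sequence \<open>u\<close> is only meaningfully accessed for \<open>n \<ge> k - 1\<close> (truncated subtraction).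
\<close>

definition bdf_alpha :: "nat \<Rightarrow> real" where
  "bdf_alpha k =
     (if k = 1 then 1
      else if k = 2 then 3/2
      else if k = 3 then 11/6
      else if k = 4 then 25/12
      else if k = 5 then 137/60
      else 49/20)"

definition bdf_A :: "nat \<Rightarrow> (nat \<Rightarrow> 'a::real_vector) \<Rightarrow> nat \<Rightarrow> 'a" where
  "bdf_A k u n =
     (if k = 1 then u n
      else if k = 2 then 2 *\<^sub>R u n - (1/2) *\<^sub>R u (n-1)
      else if k = 3 then 3 *\<^sub>R u n - (3/2) *\<^sub>R u (n-1) + (1/3) *\<^sub>R u (n-2)
      else if k = 4 then 4 *\<^sub>R u n - 3 *\<^sub>R u (n-1) + (4/3) *\<^sub>R u (n-2) - (1/4) *\<^sub>R u (n-3)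
      else if k = 5 then 5 *\<^sub>R u n - 5 *\<^sub>R u (n-1) + (10/3) *\<^sub>R u (n-2) - (5/4) *\<^sub>R u (n-3)
        + (1/5) *\<^sub>R u (n-4)
      else 6 *\<^sub>R u n - (15/2) *\<^sub>R u (n-1) + (20/3) *\<^sub>R u (n-2) - (15/4) *\<^sub>R u (n-3)
        + (6/5) *\<^sub>R u (n-4) - (1/6) *\<^sub>R u (n-5))"

definition bdf_B :: "nat \<Rightarrow> (nat \<Rightarrow> 'a::real_vector) \<Rightarrow> nat \<Rightarrow> 'a" where
  "bdf_B k u n =
     (if k = 1 then u n
      else if k = 2 then 2 *\<^sub>R u n - u (n-1)
      else if k = 3 then 3 *\<^sub>R u n - 3 *\<^sub>R u (n-1) + u (n-2)
      else if k = 4 then 4 *\<^sub>R u n - 6 *\<^sub>R u (n-1) + 4 *\<^sub>R u (n-2) - u (n-3)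
      else if k = 5 then 5 *\<^sub>R u n - 10 *\<^sub>R u (n-1) + 10 *\<^sub>R u (n-2) - 5 *\<^sub>R u (n-3) + u (n-4)
      else 6 *\<^sub>R u n - 15 *\<^sub>R u (n-1) + 20 *\<^sub>R u (n-2) - 15 *\<^sub>R u (n-3) + 6 *\<^sub>R u (n-4)
        - u (n-5))"

text \<open>
  For \<open>k = 5, 6\<close> the function is a parameter \<open>V56 k\<close>, constrained only by \<open>V56 k 1 = 1\<close>.
\<close>

definition esav_V :: "(nat \<Rightarrow> real \<Rightarrow> real) \<Rightarrow> nat \<Rightarrow> real \<Rightarrow> real" where
  "esav_V V56 k x =
     (if k = 1 then x
      else if k = 2 then x * (2 - x)
      else if k = 3 then x * (3 - 3 * x + x^2)
      else if k = 4 then x * (2 - x) * (2 - 2 * x + x^2)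
      else V56 k x)"

text \<open>
  \<open>R' (Suc n)\<close> is $\tilde R^{n+1}$; all sequences are indexed by the time level.
\<close>

definition resav2_step1 ::
  "'a::real_inner set \<Rightarrow> ('a \<Rightarrow> 'a) \<Rightarrow> ('a \<Rightarrow> 'a) \<Rightarrow> ('a \<Rightarrow> real) \<Rightarrow> ('a \<Rightarrow> real)
    \<Rightarrow> (nat \<Rightarrow> real \<Rightarrow> real) \<Rightarrow> nat \<Rightarrow> real
    \<Rightarrow> (nat \<Rightarrow> 'a) \<Rightarrow> (nat \<Rightarrow> real) \<Rightarrow> (nat \<Rightarrow> real) \<Rightarrow> (nat \<Rightarrow> real) \<Rightarrow> nat \<Rightarrow> bool" where
  "resav2_step1 D \<A> g E \<K> V56 k \<delta>t \<phi> R R' \<xi> n \<longleftrightarrow>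
     \<phi> (Suc n) \<in> D \<and>
     (bdf_alpha k *\<^sub>R \<phi> (Suc n) - bdf_A k \<phi> n) /\<^sub>R \<delta>t + \<A> (\<phi> (Suc n))
       + esav_V V56 k (\<xi> (Suc n)) *\<^sub>R g (bdf_B k \<phi> n) = 0 \<and>
     (R' (Suc n) - R n) / \<delta>t = - R' (Suc n) * \<K> (bdf_B k \<phi> n) \<and>
     \<xi> (Suc n) = R' (Suc n) / exp (E (bdf_B k \<phi> n))"

text \<open>
  The arguments of the next three definitions stand for the values
  $R' = \tilde R^{n+1}$, $e = \exp(E(\phi^{n+1}))$, $\kappa = \mathcal K(\phi^{n+1})$ and
  $\kappa B = \mathcal K(B_k(\phi^n))$. The set $\mathcal W$ is \<open>admissible_set\<close>, which does not
  itself enforce $\gamma \ge 0$.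
\<close>

definition relax :: "real \<Rightarrow> real \<Rightarrow> real \<Rightarrow> real" where
  "relax R' e \<theta> = \<theta> * R' + (1 - \<theta>) * e"

definition admissible_set :: "real \<Rightarrow> real \<Rightarrow> real \<Rightarrow> real \<Rightarrow> real \<Rightarrow> real \<Rightarrow> real set" where
  "admissible_set \<delta>t \<gamma> R' e \<kappa> \<kappa>B =
     {\<theta>\<in>{0..1}. (relax R' e \<theta> - R') / \<delta>t = - \<gamma> * R' * \<kappa> + R' * \<kappa>B}"

definition resav2_choice ::
  "real \<Rightarrow> real \<Rightarrow> real \<Rightarrow> real \<Rightarrow> real \<Rightarrow> real \<Rightarrow> real \<Rightarrow> bool" where
  "resav2_choice \<delta>t R' e \<kappa> \<kappa>B \<theta> \<gamma> \<longleftrightarrow>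
     (R' = e \<longrightarrow> \<theta> = 0 \<and> \<gamma> = \<kappa>B / \<kappa>) \<and>
     (R' > e \<longrightarrow> \<theta> = 0 \<and> \<gamma> = (R' - e) / (\<delta>t * R' * \<kappa>) + \<kappa>B / \<kappa>) \<and>
     (R' < e \<and> R' - e + \<delta>t * R' * \<kappa>B \<ge> 0 \<longrightarrow>
        \<theta> = 0 \<and> \<gamma> = (R' - e) / (\<delta>t * R' * \<kappa>) + \<kappa>B / \<kappa>) \<and>
     (R' < e \<and> R' - e + \<delta>t * R' * \<kappa>B < 0 \<longrightarrow>
        \<theta> = 1 - \<delta>t * R' * \<kappa>B / (e - R') \<and> \<gamma> = 0)"

end

theory Submission
  imports Defs
begin

text \<open>
  The equation for \<open>R'\<close> gives \<open>R' * (1 + \<delta>t * \<kappa>B) = R n\<close>, so positivity of \<open>R n\<close> passes to \<open>R'\<close>, and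
  from there to \<open>\<xi>\<close> and to the convex combination \<open>R (Suc n)\<close> of \<open>R'\<close> and \<open>e\<close>. The choice of \<open>\<gamma>\<close> makes
  the residual of the constraint defining the admissible set vanish at \<open>\<theta>\<close>; adding this constraint
  to the equation for \<open>R'\<close> cancels \<open>\<kappa>B\<close> and leaves the energy identity. Finally \<open>\<theta>\<close> is nonzero only if
  \<open>R' < e\<close>, whence \<open>R (Suc n) \<le> e\<close>.
\<close>

text \<open>Positivity of \<open>\<K>\<close> is known only on \<open>D\<close>, so the extrapolated
  state must be shown to lie there. The condition \<open>k \<le> Suc n\<close> keeps every index
  \<open>n - i\<close> with \<open>i < k\<close> free of truncation.\<close>

lemma bdf_B_in_subspace:
  assumes "subspace D" "1 \<le> k" "k \<le> 6" "k \<le> Suc n"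
    and u: "\<And>j. Suc n - k \<le> j \<Longrightarrow> j \<le> n \<Longrightarrow> u j \<in> D"
  shows "bdf_B k u n \<in> D"
proof -
  have k: "k \<in> {1, 2, 3, 4, 5, 6}"
    using assms(2,3) by auto
  have "u (n - i) \<in> D" if "i < k" for i
    using u[of "n - i"] that \<open>k \<le> Suc n\<close> by simp
  from this[of 0] this[of 1] this[of 2] this[of 3] this[of 4] this[of 5] k show ?thesis
    by (auto simp: bdf_B_def intro!: subspace_add subspace_diff subspace_scale \<open>subspace D\<close>)
qed

text \<open>The identity is linear in \<theta> and in \<gamma>: where \<theta> = 0, the prescribed
  \<gamma> is its solution; where \<gamma> = 0, the prescribed \<theta> is.\<close>

lemma resav2_choice_identity:
  assumes "resav2_choice \<delta>t R' e \<kappa> \<kappa>B \<theta> \<gamma>" "\<delta>t > 0" "R' > 0" "\<kappa> > 0"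
  shows "(R' - e) * \<theta> = R' - e - \<delta>t * \<gamma> * R' * \<kappa> + \<delta>t * R' * \<kappa>B"
proof -
  \<comment> \<open>The second alternative merges \<open>R' > e\<close> with the subcase of
    \<open>R' < e\<close> that has a nonnegative residual, since both use the same formulas.\<close>
  consider "R' = e" | "R' \<noteq> e" "\<theta> = 0" "\<gamma> = (R' - e) / (\<delta>t * R' * \<kappa>) + \<kappa>B / \<kappa>"
    | "R' < e" "\<theta> = 1 - \<delta>t * R' * \<kappa>B / (e - R')" "\<gamma> = 0"
    using assms(1) unfolding resav2_choice_def by (smt (verit))
  then show ?thesis
  proof cases
    case 1
    then show ?thesis
      using assms by (simp add: resav2_choice_def)
  next
    case 2
    then show ?thesis
      using assms by (simp add: field_simps)
  next
    case 3
    then show ?thesis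
      by (simp add: field_simps)
  qed
qed

text \<open>Over a common denominator, the numerator of \<gamma> is the very quantity whose sign
  separates the two subcases of \<open>R' < e\<close>; for \<open>R' > e\<close> it is a sum of
  positive terms.\<close>

lemma resav2_choice_gamma_nonneg:
  assumes "resav2_choice \<delta>t R' e \<kappa> \<kappa>B \<theta> \<gamma>" "\<delta>t > 0" "R' > 0" "\<kappa> > 0" "\<kappa>B > 0"
  shows "\<gamma> \<ge> 0"
proof -
  have "(R' - e) / (\<delta>t * R' * \<kappa>) + \<kappa>B / \<kappa> = (R' - e + \<delta>t * R' * \<kappa>B) / (\<delta>t * R' * \<kappa>)"
    using assms by (simp add: field_simps)
  moreover have "\<delta>t * R' * \<kappa>B > 0" "\<delta>t * R' * \<kappa> > 0"
    using assms by simp_all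
  ultimately have "(R' - e) / (\<delta>t * R' * \<kappa>) + \<kappa>B / \<kappa> \<ge> 0" if "R' - e + \<delta>t * R' * \<kappa>B \<ge> 0"
    using that by simp
  moreover have "\<kappa>B / \<kappa> \<ge> 0"
    using assms by simp
  ultimately show ?thesis
    using assms(1) \<open>\<delta>t * R' * \<kappa>B > 0\<close> unfolding resav2_choice_def by (smt (verit))
qed

text \<open>When \<theta> is not 0, the strict inequality defining that case says that the fraction
  subtracted from 1 is itself below 1.\<close>

lemma resav2_choice_theta_bounds:
  assumes "resav2_choice \<delta>t R' e \<kappa> \<kappa>B \<theta> \<gamma>" "\<delta>t > 0" "R' > 0" "\<kappa>B > 0"
  shows "\<theta> \<in> {0..1}"
proof -
  have "\<delta>t * R' * \<kappa>B > 0"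
    using assms by simp
  then have "0 \<le> \<delta>t * R' * \<kappa>B / (e - R') \<and> \<delta>t * R' * \<kappa>B / (e - R') \<le> 1"
    if "R' < e" "R' - e + \<delta>t * R' * \<kappa>B < 0"
    using that by (simp add: divide_le_eq)
  then show ?thesis
    using assms(1) unfolding resav2_choice_def atLeastAtMost_iff by (smt (verit))
qed

lemma relax_le:
  assumes "resav2_choice \<delta>t R' e \<kappa> \<kappa>B \<theta> \<gamma>" "\<theta> \<ge> 0"
  shows "relax R' e \<theta> \<le> e"
proof -
  have "\<theta> = 0 \<or> R' \<le> e"
    using assms(1) unfolding resav2_choice_def by (smt (verit))
  then have "\<theta> * (R' - e) \<le> 0"
    using \<open>\<theta> \<ge> 0\<close> by (auto simp: mult_nonneg_nonpos)
  then show ?thesis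
    by (simp add: relax_def algebra_simps)
qed

lemma relax_pos:
  assumes "\<theta> \<in> {0..1}" "R' > 0" "e > 0"
  shows "relax R' e \<theta> > 0"
\<comment> \<open>The strictly positive summand is \<open>e\<close> when \<theta> = 0, and
  \<open>\<theta> * R'\<close> otherwise.\<close>
proof (cases "\<theta> = 0")
  case True
  then show ?thesis
    using assms by (simp add: relax_def)
next
  case False
  then show ?thesis
    using assms by (simp add: relax_def add_pos_nonneg)
qed

theorem theorem3p1:
  fixes D :: "'a::real_inner set"
    and \<A> g :: "'a \<Rightarrow> 'a"
    and E \<K> :: "'a \<Rightarrow> real"
    and V56 :: "nat \<Rightarrow> real \<Rightarrow> real"
    and k n\<^sub>0 :: nat
    and N :: enat
    and \<delta>t :: real
    and \<phi> :: "nat \<Rightarrow> 'a"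
    and R R' \<xi> \<theta> \<gamma> :: "nat \<Rightarrow> real"
  assumes system: "dissipative_system D \<A> g E \<K>"
    and k: "1 \<le> k" "k \<le> 6"
    and V56: "V56 5 1 = 1" "V56 6 1 = 1"
    and dt: "\<delta>t > 0"
    and start: "k \<le> Suc n\<^sub>0" "\<forall>j\<in>{Suc n\<^sub>0 - k..n\<^sub>0}. \<phi> j \<in> D" "R n\<^sub>0 > 0"
    and step1: "\<forall>n\<ge>n\<^sub>0. enat n < N \<longrightarrow> resav2_step1 D \<A> g E \<K> V56 k \<delta>t \<phi> R R' \<xi> n"
    and choice: "\<forall>n\<ge>n\<^sub>0. enat n < N \<longrightarrow>
        resav2_choice \<delta>t (R' (Suc n)) (exp (E (\<phi> (Suc n)))) (\<K> (\<phi> (Suc n))) (\<K> (bdf_B k \<phi> n))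
          (\<theta> (Suc n)) (\<gamma> (Suc n))"
    and step2: "\<forall>n\<ge>n\<^sub>0. enat n < N \<longrightarrow>
        R (Suc n) = relax (R' (Suc n)) (exp (E (\<phi> (Suc n)))) (\<theta> (Suc n))"
  shows "\<forall>n\<ge>n\<^sub>0. enat n < N \<longrightarrow>
      (R' (Suc n) - exp (E (\<phi> (Suc n)))) * \<theta> (Suc n) =
        R' (Suc n) - exp (E (\<phi> (Suc n))) - \<delta>t * \<gamma> (Suc n) * R' (Suc n) * \<K> (\<phi> (Suc n))
          + \<delta>t * R' (Suc n) * \<K> (bdf_B k \<phi> n) \<and>
      \<gamma> (Suc n) \<ge> 0 \<and>
      \<theta> (Suc n) \<in> admissible_set \<delta>t (\<gamma> (Suc n)) (R' (Suc n)) (exp (E (\<phi> (Suc n))))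
        (\<K> (\<phi> (Suc n))) (\<K> (bdf_B k \<phi> n)) \<and>
      R (Suc n) > 0 \<and> \<xi> (Suc n) > 0 \<and>
      R (Suc n) - R n = - \<delta>t * \<gamma> (Suc n) * R' (Suc n) * \<K> (\<phi> (Suc n)) \<and>
      - \<delta>t * \<gamma> (Suc n) * R' (Suc n) * \<K> (\<phi> (Suc n)) \<le> 0 \<and>
      ln (R (Suc n)) - ln (R n) \<le> 0 \<and>
      R (Suc n) \<le> exp (E (\<phi> (Suc n)))"
proof -
  have D: "subspace D" and K_pos: "\<And>x. x \<in> D \<Longrightarrow> \<K> x > 0"
    using system by (auto simp: dissipative_system_def positive_operator_on_def)
  \<comment> \<open>The bound on \<open>n\<close> is non-strict because level \<open>n\<close> is
    produced by step \<open>n - 1\<close>; the lower bound on \<open>j\<close> reaches back to the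
    oldest starting value.\<close>
  have phi_D: "\<phi> j \<in> D" if "Suc n\<^sub>0 - k \<le> j" "j \<le> n" "enat n \<le> N" for j n
  proof (cases "j \<le> n\<^sub>0")
    case True
    then show ?thesis
      using start(2) that by simp
  next
    case False
    then obtain m where m: "j = Suc m" "n\<^sub>0 \<le> m"
      by (cases j) auto
    have "enat m < enat n"
      using m that by simp
    with that have "enat m < N"
      by (meson less_le_trans)
    then show ?thesis
      using step1 m by (auto simp: resav2_step1_def)
  qed
  have K_pos_Suc: "\<K> (\<phi> (Suc n)) > 0" if "n\<^sub>0 \<le> n" "enat n < N" for n
    using step1 that K_pos by (auto simp: resav2_step1_def)
  have K_pos_B: "\<K> (bdf_B k \<phi> n) > 0" if "n\<^sub>0 \<le> n" "enat n < N" for n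
    using that start(1) by (intro K_pos bdf_B_in_subspace D k phi_D) auto
  have R_eq: "R n = R' (Suc n) * (1 + \<delta>t * \<K> (bdf_B k \<phi> n))" if "n\<^sub>0 \<le> n" "enat n < N" for n
  proof -
    have "(R' (Suc n) - R n) / \<delta>t = - R' (Suc n) * \<K> (bdf_B k \<phi> n)"
      using step1 that by (auto simp: resav2_step1_def)
    then show ?thesis
      using dt by (simp add: field_simps)
  qed
  \<comment> \<open>Positivity of \<open>R n\<close> stays a premise here, since it is only
    available through the induction over time levels below.\<close>
  have R'_pos: "R' (Suc n) > 0" if "n\<^sub>0 \<le> n" "enat n < N" "R n > 0" for n
  proof -
    have "1 + \<delta>t * \<K> (bdf_B k \<phi> n) > 0"
      using dt K_pos_B[OF that(1,2)] by (simp add: add_pos_pos)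
    then show ?thesis
      using R_eq[OF that(1,2)] that(3) by (simp add: zero_less_mult_iff)
  qed
  have R_Suc_pos: "R (Suc n) > 0" if "n\<^sub>0 \<le> n" "enat n < N" "R n > 0" for n
    using step2 choice that R'_pos[OF that] K_pos_B[OF that(1,2)] dt
    by (auto intro!: relax_pos resav2_choice_theta_bounds)
  have R_pos: "R n > 0" if "n\<^sub>0 \<le> n" "enat n \<le> N" for n
    using that
  proof (induction n rule: dec_induct)
    case base
    show ?case
      by (fact start(3))
  next
    \<comment> \<open>\<open>enat (Suc n) \<le> N\<close> amounts to \<open>enat n < N\<close>, so
      the step that computes \<open>R (Suc n)\<close> is one that the scheme performs.\<close>
    case (step n)
    then have "enat n < N"
      by (simp add: Suc_ile_eq)
    then show ?case
      using R_Suc_pos step by simp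
  qed
  show ?thesis
  proof (intro allI impI)
    fix n
    assume n: "n\<^sub>0 \<le> n" "enat n < N"
    define e where "e = exp (E (\<phi> (Suc n)))"
    define \<kappa> where "\<kappa> = \<K> (\<phi> (Suc n))"
    define \<kappa>B where "\<kappa>B = \<K> (bdf_B k \<phi> n)"
    have Rn: "R n > 0"
      using R_pos n by simp
    have pos: "R' (Suc n) > 0" "R (Suc n) > 0" "\<kappa> > 0" "\<kappa>B > 0"
      using R'_pos[OF n Rn] R_Suc_pos[OF n Rn] K_pos_Suc[OF n] K_pos_B[OF n]
      by (simp_all add: \<kappa>_def \<kappa>B_def)
    have ch: "resav2_choice \<delta>t (R' (Suc n)) e \<kappa> \<kappa>B (\<theta> (Suc n)) (\<gamma> (Suc n))"
      using choice n by (simp add: e_def \<kappa>_def \<kappa>B_def)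
    note id = resav2_choice_identity[OF ch dt pos(1,3)]
    note \<gamma> = resav2_choice_gamma_nonneg[OF ch dt pos(1,3,4)]
    note \<theta> = resav2_choice_theta_bounds[OF ch dt pos(1,4)]
    have R_Suc: "R (Suc n) = relax (R' (Suc n)) e (\<theta> (Suc n))"
      using step2 n by (simp add: e_def)
    \<comment> \<open>The left side equals \<open>(1 - \<theta> (Suc n)) * (e - R' (Suc n))\<close>,
      so this is \<open>id\<close> rearranged into the constraint of the admissible set, multiplied
      by \<open>\<delta>t\<close>.\<close>
    have diff: "relax (R' (Suc n)) e (\<theta> (Suc n)) - R' (Suc n) =
        \<delta>t * (- \<gamma> (Suc n) * R' (Suc n) * \<kappa> + R' (Suc n) * \<kappa>B)"
      using id by (simp add: relax_def algebra_simps)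
    have W: "\<theta> (Suc n) \<in> admissible_set \<delta>t (\<gamma> (Suc n)) (R' (Suc n)) e \<kappa> \<kappa>B"
      using \<theta> diff dt by (simp add: admissible_set_def)
    have energy: "R (Suc n) - R n = - \<delta>t * \<gamma> (Suc n) * R' (Suc n) * \<kappa>"
      using diff R_eq[OF n] by (simp add: R_Suc \<kappa>B_def algebra_simps)
    have dissip: "- \<delta>t * \<gamma> (Suc n) * R' (Suc n) * \<kappa> \<le> 0"
      using dt \<gamma> pos by simp
    have "ln (R (Suc n)) - ln (R n) \<le> 0"
      using energy dissip Rn pos by simp
    moreover have "\<xi> (Suc n) > 0"
      using step1 n pos by (auto simp: resav2_step1_def)
    moreover have "R (Suc n) \<le> e"
      using relax_le[OF ch] \<theta> by (simp add: R_Suc)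
    ultimately show "(R' (Suc n) - exp (E (\<phi> (Suc n)))) * \<theta> (Suc n) =
        R' (Suc n) - exp (E (\<phi> (Suc n))) - \<delta>t * \<gamma> (Suc n) * R' (Suc n) * \<K> (\<phi> (Suc n))
          + \<delta>t * R' (Suc n) * \<K> (bdf_B k \<phi> n) \<and>
      \<gamma> (Suc n) \<ge> 0 \<and>
      \<theta> (Suc n) \<in> admissible_set \<delta>t (\<gamma> (Suc n)) (R' (Suc n)) (exp (E (\<phi> (Suc n))))
        (\<K> (\<phi> (Suc n))) (\<K> (bdf_B k \<phi> n)) \<and>
      R (Suc n) > 0 \<and> \<xi> (Suc n) > 0 \<and>
      R (Suc n) - R n = - \<delta>t * \<gamma> (Suc n) * R' (Suc n) * \<K> (\<phi> (Suc n)) \<and>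
      - \<delta>t * \<gamma> (Suc n) * R' (Suc n) * \<K> (\<phi> (Suc n)) \<le> 0 \<and>
      ln (R (Suc n)) - ln (R n) \<le> 0 \<and>
      R (Suc n) \<le> exp (E (\<phi> (Suc n)))"
      using id \<gamma> W pos(2) energy dissip unfolding e_def \<kappa>_def \<kappa>B_def by (intro conjI)
  qed
qed

end
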